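(* Let $v\ge0$, let $\varsigma\in\mathcal{S}_p(v,0)$ be a prime substitution, and let $d\ge0$. Then: (a) the map $\mu\mapsto\mu\circ\varsigma$ is a bijection of the set of level-$d$ minterms of $\mathbf{K}[v,d]$ onto itself (in particular $\mu\circ\varsigma$ is again a minterm); (b) the map $\varphi\mapsto\varphi\circ\varsigma$ is a lattice automorphism of $\mathbf{K}[v,d]$.
   Context: Formulas are unimodal propositional formulas in variables $p_0,\dots,p_{v-1}$; $\mathbf{K}$ is the least normal modal logic. $\mathbf{K}[v,d]$ is the Lindenbaum–Tarski algebra of formulas in $p_0,\dots,p_{v-1}$ of modal degree $\le d$ modulo $\mathbf{K}$-equivalence; it is a finite Boolean algebra whose atoms (minterms) are: level 0: the $2^v$ conjunctions $\bigwedge_i\pm p_i$; level $d+1$: all $m\wedge\bigwedge_\mu\pm\Diamond\mu$ with $m$ a level-0 minterm and $\mu$ ranging over all level-$d$ minterms (all sign choices). A level-0 substitution is a tuple $\sigma=(\sigma_0,\dots,\sigma_{v-1})$ of classical propositional formulas (up to equivalence) in $p_0,\dots,p_{v-1}$, acting by $\varphi\circ\sigma=\varphi(\sigma_0,\dots,\sigma_{v-1})$ (well defined on $\mathbf{K}$-classes); composition $(\sigma\sigma')_i=\sigma_i(\sigma'_0,\dots,\sigma'_{v-1})$ makes these a monoid with identity $(p_0,\dots,p_{v-1})$, and the prime substitutions are its invertible elements, forming the group $\mathcal{S}_p(v,0)$. *)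

theory Defs
  imports "HOL-Algebra.Group" "HOL-Algebra.Lattice"
begin

section \<open>Modal formulas and the logic K\<close>

datatype fm = Bot | Var nat | Imp fm fm | Box fm

abbreviation Neg :: "fm \<Rightarrow> fm" where "Neg \<phi> \<equiv> Imp \<phi> Bot"
abbreviation Top :: fm where "Top \<equiv> Neg Bot"
abbreviation Or :: "fm \<Rightarrow> fm \<Rightarrow> fm" where "Or \<phi> \<psi> \<equiv> Imp (Neg \<phi>) \<psi>"
abbreviation And :: "fm \<Rightarrow> fm \<Rightarrow> fm" where "And \<phi> \<psi> \<equiv> Neg (Imp \<phi> (Neg \<psi>))"
abbreviation Iff :: "fm \<Rightarrow> fm \<Rightarrow> fm" where "Iff \<phi> \<psi> \<equiv> And (Imp \<phi> \<psi>) (Imp \<psi> \<phi>)"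
abbreviation Dia :: "fm \<Rightarrow> fm" where "Dia \<phi> \<equiv> Neg (Box (Neg \<phi>))"

primrec vars :: "fm \<Rightarrow> nat set" where
  "vars Bot = {}"
| "vars (Var i) = {i}"
| "vars (Imp \<phi> \<psi>) = vars \<phi> \<union> vars \<psi>"
| "vars (Box \<phi>) = vars \<phi>"

primrec deg :: "fm \<Rightarrow> nat" where
  "deg Bot = 0"
| "deg (Var i) = 0"
| "deg (Imp \<phi> \<psi>) = max (deg \<phi>) (deg \<psi>)"
| "deg (Box \<phi>) = Suc (deg \<phi>)"

primrec subst :: "(nat \<Rightarrow> fm) \<Rightarrow> fm \<Rightarrow> fm" where
  "subst \<sigma> Bot = Bot"
| "subst \<sigma> (Var i) = \<sigma> i"
| "subst \<sigma> (Imp \<phi> \<psi>) = Imp (subst \<sigma> \<phi>) (subst \<sigma> \<psi>)"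
| "subst \<sigma> (Box \<phi>) = Box (subst \<sigma> \<phi>)"

text \<open>Classical truth: variables and boxed formulas are evaluated as atoms by \<open>V\<close>.\<close>

primrec tval :: "(fm \<Rightarrow> bool) \<Rightarrow> fm \<Rightarrow> bool" where
  "tval V Bot \<longleftrightarrow> False"
| "tval V (Var i) \<longleftrightarrow> V (Var i)"
| "tval V (Imp \<phi> \<psi>) \<longleftrightarrow> (tval V \<phi> \<longrightarrow> tval V \<psi>)"
| "tval V (Box \<phi>) \<longleftrightarrow> V (Box \<phi>)"

definition taut :: "fm \<Rightarrow> bool" where
  "taut \<phi> \<longleftrightarrow> (\<forall>V. tval V \<phi>)"

definition normal_logic :: "fm set \<Rightarrow> bool" where
  "normal_logic L \<longleftrightarrow>
     (\<forall>\<phi>. taut \<phi> \<longrightarrow> \<phi> \<in> L) \<and>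
     (\<forall>\<phi> \<psi>. Imp (Box (Imp \<phi> \<psi>)) (Imp (Box \<phi>) (Box \<psi>)) \<in> L) \<and>
     (\<forall>\<phi> \<psi>. \<phi> \<in> L \<longrightarrow> Imp \<phi> \<psi> \<in> L \<longrightarrow> \<psi> \<in> L) \<and>
     (\<forall>\<phi>. \<phi> \<in> L \<longrightarrow> Box \<phi> \<in> L) \<and>
     (\<forall>\<phi> \<sigma>. \<phi> \<in> L \<longrightarrow> subst \<sigma> \<phi> \<in> L)"

definition logicK :: "fm set" where
  "logicK = \<Inter>{L. normal_logic L}"


section \<open>The Lindenbaum--Tarski algebras\<close>

definition forms :: "nat \<Rightarrow> nat \<Rightarrow> fm set" where
  "forms v d = {\<phi>. vars \<phi> \<subseteq> {..<v} \<and> deg \<phi> \<le> d}"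

definition K_rel :: "nat \<Rightarrow> nat \<Rightarrow> (fm \<times> fm) set" where
  "K_rel v d = {(\<phi>, \<psi>). \<phi> \<in> forms v d \<and> \<psi> \<in> forms v d \<and> Iff \<phi> \<psi> \<in> logicK}"

definition K_cls :: "nat \<Rightarrow> nat \<Rightarrow> fm \<Rightarrow> fm set" where
  "K_cls v d \<phi> = K_rel v d `` {\<phi>}"

text \<open>The algebra is given by its lattice order; that joins and meets in this order are the
  classes of disjunctions and conjunctions is \<open>K_alg_join\<close> and \<open>K_alg_meet\<close> below.\<close>

definition K_alg :: "nat \<Rightarrow> nat \<Rightarrow> fm set gorder" where
  "K_alg v d = \<lparr>carrier = forms v d // K_rel v d, eq = (=),
     le = (\<lambda>X Y. \<exists>\<phi>\<in>X. \<exists>\<psi>\<in>Y. Imp \<phi> \<psi> \<in> logicK)\<rparr>"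

definition lattice_automorphism :: "('a, 'b) gorder_scheme \<Rightarrow> ('a \<Rightarrow> 'a) \<Rightarrow> bool" where
  "lattice_automorphism L f \<longleftrightarrow>
     bij_betw f (carrier L) (carrier L) \<and> join_pres L L f \<and> meet_pres L L f"


section \<open>Minterms\<close>

definition lit :: "bool \<Rightarrow> fm \<Rightarrow> fm" where
  "lit b \<phi> = (if b then \<phi> else Neg \<phi>)"

definition Conj :: "fm list \<Rightarrow> fm" where
  "Conj \<phi>s = foldr And \<phi>s Top"

definition signed_conjs :: "fm list \<Rightarrow> fm list" where
  "signed_conjs \<phi>s = map (\<lambda>bs. Conj (map2 lit bs \<phi>s)) (List.n_lists (length \<phi>s) [True, False])"

text \<open>Lists rather than sets, so that the conjunction over all minterms of the previous level
  is a formula.\<close>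

primrec minterm_list :: "nat \<Rightarrow> nat \<Rightarrow> fm list" where
  "minterm_list v 0 = signed_conjs (map Var [0..<v])"
| "minterm_list v (Suc d) =
     [And m c. m \<leftarrow> signed_conjs (map Var [0..<v]), c \<leftarrow> signed_conjs (map Dia (minterm_list v d))]"

definition minterms :: "nat \<Rightarrow> nat \<Rightarrow> fm set set" where
  "minterms v d = K_cls v d ` set (minterm_list v d)"


section \<open>Level-0 substitutions\<close>

definition C_rel :: "nat \<Rightarrow> (fm \<times> fm) set" where
  "C_rel v = {(\<phi>, \<psi>). \<phi> \<in> forms v 0 \<and> \<psi> \<in> forms v 0 \<and> taut (Iff \<phi> \<psi>)}"

definition rep :: "fm set \<Rightarrow> fm" where
  "rep X = (SOME \<phi>. \<phi> \<in> X)"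

definition subst_monoid :: "nat \<Rightarrow> (nat \<Rightarrow> fm set) monoid" where
  "subst_monoid v =
    \<lparr>carrier = {..<v} \<rightarrow>\<^sub>E (forms v 0 // C_rel v),
     mult = (\<lambda>S T. \<lambda>i\<in>{..<v}. C_rel v `` {subst (\<lambda>j. rep (T j)) (rep (S i))}),
     one = (\<lambda>i\<in>{..<v}. C_rel v `` {Var i})\<rparr>"

definition prime_substs :: "nat \<Rightarrow> (nat \<Rightarrow> fm set) monoid" where
  "prime_substs v = units_of (subst_monoid v)"

text \<open>The action \<open>\<phi> \<mapsto> \<phi> \<circ> \<sigma>\<close> on classes; independence of the representatives is
  \<open>K_act_cls\<close> below.\<close>

definition K_act :: "nat \<Rightarrow> nat \<Rightarrow> (nat \<Rightarrow> fm set) \<Rightarrow> fm set \<Rightarrow> fm set" where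
  "K_act v d S X = K_cls v d (subst (\<lambda>i. rep (S i)) (rep X))"


section \<open>Well-definedness\<close>

lemma normal_logicK: "normal_logic logicK"
  unfolding logicK_def normal_logic_def by blast

lemma K_taut: "taut \<phi> \<Longrightarrow> \<phi> \<in> logicK"
  and K_dist: "Imp (Box (Imp \<phi> \<psi>)) (Imp (Box \<phi>) (Box \<psi>)) \<in> logicK"
  and K_mp: "\<phi> \<in> logicK \<Longrightarrow> Imp \<phi> \<psi> \<in> logicK \<Longrightarrow> \<psi> \<in> logicK"
  and K_nec: "\<phi> \<in> logicK \<Longrightarrow> Box \<phi> \<in> logicK"
  and K_subst: "\<phi> \<in> logicK \<Longrightarrow> subst \<sigma> \<phi> \<in> logicK"
  using normal_logicK unfolding normal_logic_def by blast+

lemma K_taut1: "\<phi> \<in> logicK \<Longrightarrow> taut (Imp \<phi> \<chi>) \<Longrightarrow> \<chi> \<in> logicK"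
  using K_taut K_mp by blast

lemma K_taut2: "\<phi> \<in> logicK \<Longrightarrow> \<psi> \<in> logicK \<Longrightarrow> taut (Imp \<phi> (Imp \<psi> \<chi>)) \<Longrightarrow> \<chi> \<in> logicK"
  using K_taut K_mp by blast

lemma K_Iff: "Iff \<phi> \<psi> \<in> logicK \<longleftrightarrow> Imp \<phi> \<psi> \<in> logicK \<and> Imp \<psi> \<phi> \<in> logicK"
proof
  assume *: "Iff \<phi> \<psi> \<in> logicK"
  show "Imp \<phi> \<psi> \<in> logicK \<and> Imp \<psi> \<phi> \<in> logicK"
    by (intro conjI; rule K_taut1[OF *]) (auto simp: taut_def)
next
  assume *: "Imp \<phi> \<psi> \<in> logicK \<and> Imp \<psi> \<phi> \<in> logicK"
  show "Iff \<phi> \<psi> \<in> logicK"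
    by (rule K_taut2[OF conjunct1[OF *] conjunct2[OF *]]) (simp add: taut_def)
qed

lemma K_Imp_refl: "Imp \<phi> \<phi> \<in> logicK"
  by (rule K_taut) (simp add: taut_def)

lemma K_Imp_trans: "Imp \<phi> \<psi> \<in> logicK \<Longrightarrow> Imp \<psi> \<chi> \<in> logicK \<Longrightarrow> Imp \<phi> \<chi> \<in> logicK"
  by (erule K_taut2, assumption) (simp add: taut_def)

lemma K_Box_mono: "Imp \<phi> \<psi> \<in> logicK \<Longrightarrow> Imp (Box \<phi>) (Box \<psi>) \<in> logicK"
  using K_nec K_dist K_mp by blast

lemma K_subst_cong:
  "(\<And>i. i \<in> vars \<phi> \<Longrightarrow> Iff (\<sigma> i) (\<tau> i) \<in> logicK) \<Longrightarrow> Iff (subst \<sigma> \<phi>) (subst \<tau> \<phi>) \<in> logicK"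
proof (induction \<phi>)
  case (Imp \<phi> \<psi>)
  then have "Iff (subst \<sigma> \<phi>) (subst \<tau> \<phi>) \<in> logicK" "Iff (subst \<sigma> \<psi>) (subst \<tau> \<psi>) \<in> logicK"
    by simp_all
  then show ?case
    by (rule K_taut2) (auto simp: taut_def)
next
  case (Box \<phi>)
  then show ?case by (simp add: K_Iff K_Box_mono)
qed (auto simp: K_Iff K_Imp_refl)

lemma taut_Iff: "taut (Iff \<phi> \<psi>) \<longleftrightarrow> (\<forall>V. tval V \<phi> = tval V \<psi>)"
  unfolding taut_def by (rule iff_allI) auto

lemma tval_subst:
  "tval V (subst \<sigma> \<phi>) =
   tval (\<lambda>\<chi>. case \<chi> of Var i \<Rightarrow> tval V (\<sigma> i) | Box \<psi> \<Rightarrow> V (Box (subst \<sigma> \<psi>)) | _ \<Rightarrow> False) \<phi>"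
  by (induction \<phi>) auto

lemma taut_subst: "taut \<phi> \<Longrightarrow> taut (subst \<sigma> \<phi>)"
  by (simp add: taut_def tval_subst)

lemma taut_subst_cong:
  assumes "deg \<phi> = 0" "\<And>i. i \<in> vars \<phi> \<Longrightarrow> taut (Iff (\<sigma> i) (\<tau> i))"
  shows "taut (Iff (subst \<sigma> \<phi>) (subst \<tau> \<phi>))"
  using assms by (induction \<phi>) (auto simp: taut_Iff)

lemma vars_subst: "vars (subst \<sigma> \<phi>) = (\<Union>i\<in>vars \<phi>. vars (\<sigma> i))"
  by (induction \<phi>) auto

lemma deg_subst: "(\<And>i. i \<in> vars \<phi> \<Longrightarrow> deg (\<sigma> i) = 0) \<Longrightarrow> deg (subst \<sigma> \<phi>) = deg \<phi>"
  by (induction \<phi>) auto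

lemma subst_forms:
  assumes "\<phi> \<in> forms v d" "\<And>i. i < v \<Longrightarrow> \<sigma> i \<in> forms v 0"
  shows "subst \<sigma> \<phi> \<in> forms v d"
proof -
  have "deg (subst \<sigma> \<phi>) = deg \<phi>"
    using assms by (intro deg_subst) (auto simp: forms_def)
  then show ?thesis using assms by (auto simp: forms_def vars_subst)
qed

lemma subst_subst: "subst \<tau> (subst \<sigma> \<phi>) = subst (\<lambda>i. subst \<tau> (\<sigma> i)) \<phi>"
  by (induction \<phi>) auto

lemma subst_Var: "subst Var \<phi> = \<phi>"
  by (induction \<phi>) auto

lemma K_rel_equiv: "equiv (forms v d) (K_rel v d)"
proof (rule equivI)
  show "trans (K_rel v d)"
    by (auto simp: trans_def K_rel_def K_Iff intro: K_Imp_trans)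
qed (auto simp: K_rel_def refl_on_def sym_def K_Iff K_Imp_refl)

lemma C_rel_equiv: "equiv (forms v 0) (C_rel v)"
  by (rule equivI) (auto simp only: C_rel_def refl_on_def sym_def trans_def taut_Iff)

lemma rep_in_K: "X \<in> forms v d // K_rel v d \<Longrightarrow> rep X \<in> X"
  unfolding rep_def by (metis K_rel_equiv in_quotient_imp_non_empty some_in_eq)

lemma rep_in_C: "X \<in> forms v 0 // C_rel v \<Longrightarrow> rep X \<in> X"
  unfolding rep_def by (metis C_rel_equiv in_quotient_imp_non_empty some_in_eq)

lemma K_quotient_rel:
  "X \<in> forms v d // K_rel v d \<Longrightarrow> \<phi> \<in> X \<Longrightarrow> \<psi> \<in> X \<Longrightarrow> (\<phi>, \<psi>) \<in> K_rel v d"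
  by (metis K_rel_equiv quotient_eq_iff)

lemma C_quotient_rel:
  "X \<in> forms v 0 // C_rel v \<Longrightarrow> \<phi> \<in> X \<Longrightarrow> \<psi> \<in> X \<Longrightarrow> (\<phi>, \<psi>) \<in> C_rel v"
  by (metis C_rel_equiv quotient_eq_iff)

lemma K_cls_eq: "(\<phi>, \<psi>) \<in> K_rel v d \<Longrightarrow> K_cls v d \<phi> = K_cls v d \<psi>"
  unfolding K_cls_def by (rule equiv_class_eq[OF K_rel_equiv])

lemma K_cls_carrier: "\<phi> \<in> forms v d \<Longrightarrow> K_cls v d \<phi> \<in> carrier (K_alg v d)"
  by (simp add: K_alg_def K_cls_def quotientI)

lemma K_alg_carrierE:
  assumes "X \<in> carrier (K_alg v d)"
  obtains \<phi> where "\<phi> \<in> forms v d" "X = K_cls v d \<phi>"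
  using assms by (auto simp: K_alg_def K_cls_def elim: quotientE)

lemma K_alg_le:
  assumes "\<phi> \<in> forms v d" "\<psi> \<in> forms v d"
  shows "K_cls v d \<phi> \<sqsubseteq>\<^bsub>K_alg v d\<^esub> K_cls v d \<psi> \<longleftrightarrow> Imp \<phi> \<psi> \<in> logicK"
proof
  assume "Imp \<phi> \<psi> \<in> logicK"
  moreover have "\<phi> \<in> K_cls v d \<phi>" "\<psi> \<in> K_cls v d \<psi>"
    using assms by (simp_all add: K_cls_def K_rel_def K_Iff K_Imp_refl)
  ultimately show "K_cls v d \<phi> \<sqsubseteq>\<^bsub>K_alg v d\<^esub> K_cls v d \<psi>"
    by (auto simp: K_alg_def)
next
  assume "K_cls v d \<phi> \<sqsubseteq>\<^bsub>K_alg v d\<^esub> K_cls v d \<psi>"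
  then show "Imp \<phi> \<psi> \<in> logicK"
    unfolding K_alg_def K_cls_def K_rel_def by simp (metis K_Iff K_Imp_trans)
qed

lemma K_alg_partial_order: "partial_order (K_alg v d)"
proof
  fix x y assume "x \<sqsubseteq>\<^bsub>K_alg v d\<^esub> y" "y \<sqsubseteq>\<^bsub>K_alg v d\<^esub> x"
    "x \<in> carrier (K_alg v d)" "y \<in> carrier (K_alg v d)"
  then show "x .=\<^bsub>K_alg v d\<^esub> y"
    by (auto elim!: K_alg_carrierE simp: K_alg_le)
       (simp add: K_alg_def, rule K_cls_eq, simp add: K_rel_def K_Iff)
next
  fix x y z assume "x \<sqsubseteq>\<^bsub>K_alg v d\<^esub> y" "y \<sqsubseteq>\<^bsub>K_alg v d\<^esub> z"
    "x \<in> carrier (K_alg v d)" "y \<in> carrier (K_alg v d)" "z \<in> carrier (K_alg v d)"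
  then show "x \<sqsubseteq>\<^bsub>K_alg v d\<^esub> z"
    by (auto elim!: K_alg_carrierE simp: K_alg_le intro: K_Imp_trans)
next
  fix x assume "x \<in> carrier (K_alg v d)"
  then show "x \<sqsubseteq>\<^bsub>K_alg v d\<^esub> x"
    by (auto elim!: K_alg_carrierE simp: K_alg_le K_Imp_refl)
qed (auto simp: K_alg_def)

lemma forms_simps [simp]:
  "Bot \<in> forms v d" "Var i \<in> forms v d \<longleftrightarrow> i < v"
  "Imp \<phi> \<psi> \<in> forms v d \<longleftrightarrow> \<phi> \<in> forms v d \<and> \<psi> \<in> forms v d"
  "Box \<phi> \<in> forms v (Suc d) \<longleftrightarrow> \<phi> \<in> forms v d"
  by (auto simp: forms_def)

lemma K_alg_least:
  assumes "\<phi> \<in> forms v d" "\<psi> \<in> forms v d"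
  shows "least (K_alg v d) (K_cls v d (Or \<phi> \<psi>)) (Upper (K_alg v d) {K_cls v d \<phi>, K_cls v d \<psi>})"
proof -
  have "Imp \<phi> (Or \<phi> \<psi>) \<in> logicK" "Imp \<psi> (Or \<phi> \<psi>) \<in> logicK"
    by (auto simp: taut_def intro: K_taut)
  moreover have "Imp (Or \<phi> \<psi>) \<chi> \<in> logicK" if "Imp \<phi> \<chi> \<in> logicK" "Imp \<psi> \<chi> \<in> logicK" for \<chi>
    using that by (rule K_taut2) (auto simp: taut_def)
  ultimately show ?thesis
    using assms by (auto simp: least_def Upper_def K_alg_le K_cls_carrier elim!: K_alg_carrierE)
qed

lemma K_alg_greatest:
  assumes "\<phi> \<in> forms v d" "\<psi> \<in> forms v d"
  shows "greatest (K_alg v d) (K_cls v d (And \<phi> \<psi>)) (Lower (K_alg v d) {K_cls v d \<phi>, K_cls v d \<psi>})"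
proof -
  have "Imp (And \<phi> \<psi>) \<phi> \<in> logicK" "Imp (And \<phi> \<psi>) \<psi> \<in> logicK"
    by (auto simp: taut_def intro: K_taut)
  moreover have "Imp \<chi> (And \<phi> \<psi>) \<in> logicK" if "Imp \<chi> \<phi> \<in> logicK" "Imp \<chi> \<psi> \<in> logicK" for \<chi>
    using that by (rule K_taut2) (auto simp: taut_def)
  ultimately show ?thesis
    using assms by (auto simp: greatest_def Lower_def K_alg_le K_cls_carrier elim!: K_alg_carrierE)
qed

lemma K_alg_lattice: "lattice (K_alg v d)"
proof -
  interpret partial_order "K_alg v d" by (rule K_alg_partial_order)
  show ?thesis
    by unfold_locales (blast elim: K_alg_carrierE intro: K_alg_least K_alg_greatest)+
qed

lemma K_alg_join:
  assumes "\<phi> \<in> forms v d" "\<psi> \<in> forms v d"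
  shows "K_cls v d \<phi> \<squnion>\<^bsub>K_alg v d\<^esub> K_cls v d \<psi> = K_cls v d (Or \<phi> \<psi>)"
  unfolding join_def sup_def
  by (rule some_equality, rule K_alg_least[OF assms])
     (rule partial_order.least_unique[OF K_alg_partial_order _ K_alg_least[OF assms]])

lemma K_alg_meet:
  assumes "\<phi> \<in> forms v d" "\<psi> \<in> forms v d"
  shows "K_cls v d \<phi> \<sqinter>\<^bsub>K_alg v d\<^esub> K_cls v d \<psi> = K_cls v d (And \<phi> \<psi>)"
  unfolding meet_def inf_def
  by (rule some_equality, rule K_alg_greatest[OF assms])
     (rule partial_order.greatest_unique[OF K_alg_partial_order _ K_alg_greatest[OF assms]])

lemma rep_subst_forms:
  assumes "S \<in> carrier (subst_monoid v)" "i < v"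
  shows "rep (S i) \<in> forms v 0"
proof -
  have S: "S i \<in> forms v 0 // C_rel v" using assms by (auto simp: subst_monoid_def)
  then show ?thesis using C_quotient_rel[OF S rep_in_C[OF S] rep_in_C[OF S]] by (simp add: C_rel_def)
qed

lemma rep_subst_rel:
  assumes "S \<in> carrier (subst_monoid v)" "i < v" "\<phi> \<in> S i"
  shows "(rep (S i), \<phi>) \<in> C_rel v"
proof -
  have S: "S i \<in> forms v 0 // C_rel v" using assms by (auto simp: subst_monoid_def)
  show ?thesis by (rule C_quotient_rel[OF S rep_in_C[OF S] assms(3)])
qed

lemma K_act_cls:
  assumes S: "S \<in> carrier (subst_monoid v)" and \<sigma>: "\<And>i. i < v \<Longrightarrow> \<sigma> i \<in> S i"
    and \<phi>: "\<phi> \<in> forms v d"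
  shows "K_act v d S (K_cls v d \<phi>) = K_cls v d (subst \<sigma> \<phi>)"
proof -
  let ?r = "\<lambda>i. rep (S i)" and ?X = "K_cls v d \<phi>"
  have C: "(?r i, \<sigma> i) \<in> C_rel v" if "i < v" for i
    using that S \<sigma> by (auto intro: rep_subst_rel)
  have X: "?X \<in> forms v d // K_rel v d" using \<phi> by (simp add: K_cls_def quotientI)
  have "\<phi> \<in> ?X" using \<phi> by (simp add: K_cls_def K_rel_def K_Iff K_Imp_refl)
  then have R: "(rep ?X, \<phi>) \<in> K_rel v d" using K_quotient_rel[OF X rep_in_K[OF X]] by blast
  have "subst ?r (Iff (rep ?X) \<phi>) \<in> logicK"
    using R by (intro K_subst) (simp add: K_rel_def)
  then have 1: "Iff (subst ?r (rep ?X)) (subst ?r \<phi>) \<in> logicK" by simp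
  have 2: "Iff (subst ?r \<phi>) (subst \<sigma> \<phi>) \<in> logicK"
    using C \<phi> by (intro K_subst_cong K_taut) (auto simp: C_rel_def forms_def)
  have "Iff (subst ?r (rep ?X)) (subst \<sigma> \<phi>) \<in> logicK"
    using 1 2 unfolding K_Iff by (blast intro: K_Imp_trans)
  moreover have "subst ?r (rep ?X) \<in> forms v d" "subst \<sigma> \<phi> \<in> forms v d"
    using R \<phi> C by (auto intro!: subst_forms simp: K_rel_def C_rel_def)
  ultimately show ?thesis
    unfolding K_act_def by (intro K_cls_eq) (simp add: K_rel_def)
qed

lemma subst_mult:
  assumes S: "S \<in> carrier (subst_monoid v)" and T: "T \<in> carrier (subst_monoid v)"
    and \<sigma>: "\<And>i. i < v \<Longrightarrow> \<sigma> i \<in> S i" and \<tau>: "\<And>i. i < v \<Longrightarrow> \<tau> i \<in> T i"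
  shows "S \<otimes>\<^bsub>subst_monoid v\<^esub> T = (\<lambda>i\<in>{..<v}. C_rel v `` {subst \<tau> (\<sigma> i)})"
proof -
  let ?s = "\<lambda>i. rep (S i)" and ?t = "\<lambda>i. rep (T i)"
  have C: "(?s i, \<sigma> i) \<in> C_rel v" "(?t i, \<tau> i) \<in> C_rel v" if "i < v" for i
    using that S T \<sigma> \<tau> by (auto intro: rep_subst_rel)
  have "C_rel v `` {subst ?t (?s i)} = C_rel v `` {subst \<tau> (\<sigma> i)}" if i: "i < v" for i
  proof (rule equiv_class_eq[OF C_rel_equiv])
    have "taut (subst ?t (Iff (?s i) (\<sigma> i)))"
      using C(1)[OF i] by (intro taut_subst) (simp add: C_rel_def)
    moreover have "taut (Iff (subst ?t (\<sigma> i)) (subst \<tau> (\<sigma> i)))"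
      using C(1)[OF i] C(2) by (intro taut_subst_cong) (auto simp: C_rel_def forms_def)
    ultimately have "taut (Iff (subst ?t (?s i)) (subst \<tau> (\<sigma> i)))"
      by (auto simp only: subst.simps taut_Iff)
    moreover have "subst ?t (?s i) \<in> forms v 0" "subst \<tau> (\<sigma> i) \<in> forms v 0"
      using C(1)[OF i] C(2) by (auto intro!: subst_forms simp: C_rel_def)
    ultimately show "(subst ?t (?s i), subst \<tau> (\<sigma> i)) \<in> C_rel v"
      by (simp add: C_rel_def)
  qed
  then show ?thesis by (auto simp: subst_monoid_def intro!: restrict_ext)
qed

lemma C_cls_self: "\<phi> \<in> forms v 0 \<Longrightarrow> \<phi> \<in> C_rel v `` {\<phi>}"
  by (rule equiv_class_self[OF C_rel_equiv])

lemma subst_monoidI: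
  "(\<And>i. i < v \<Longrightarrow> \<sigma> i \<in> forms v 0) \<Longrightarrow>
   (\<lambda>i\<in>{..<v}. C_rel v `` {\<sigma> i}) \<in> carrier (subst_monoid v)"
  by (auto simp: subst_monoid_def intro: quotientI)

lemma subst_monoidE:
  assumes "S \<in> carrier (subst_monoid v)"
  obtains \<sigma> where "\<And>i. i < v \<Longrightarrow> \<sigma> i \<in> forms v 0" "S = (\<lambda>i\<in>{..<v}. C_rel v `` {\<sigma> i})"
proof
  show "rep (S i) \<in> forms v 0" if "i < v" for i
    using rep_subst_forms[OF assms that] .
  show "S = (\<lambda>i\<in>{..<v}. C_rel v `` {rep (S i)})"
  proof
    fix i
    show "S i = (\<lambda>i\<in>{..<v}. C_rel v `` {rep (S i)}) i"
    proof (cases "i < v")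
      case True
      then have S: "S i \<in> forms v 0 // C_rel v" using assms by (auto simp: subst_monoid_def)
      then obtain \<phi> where "\<phi> \<in> forms v 0" "S i = C_rel v `` {\<phi>}" by (elim quotientE)
      moreover from this rep_in_C[OF S] have "(\<phi>, rep (S i)) \<in> C_rel v" by blast
      ultimately have "S i = C_rel v `` {rep (S i)}"
        using equiv_class_eq[OF C_rel_equiv, of \<phi> "rep (S i)" v] by metis
      moreover have "(\<lambda>i\<in>{..<v}. C_rel v `` {rep (S i)}) i = C_rel v `` {rep (S i)}"
        using True by simp
      ultimately show ?thesis by (rule trans[OF _ sym])
    next
      case False
      then show ?thesis using assms by (auto simp: subst_monoid_def PiE_iff extensional_def)
    qed
  qed
qed

lemma subst_mult_cls:
  assumes "\<And>i. i < v \<Longrightarrow> \<sigma> i \<in> forms v 0" "\<And>i. i < v \<Longrightarrow> \<tau> i \<in> forms v 0"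
  shows "(\<lambda>i\<in>{..<v}. C_rel v `` {\<sigma> i}) \<otimes>\<^bsub>subst_monoid v\<^esub> (\<lambda>i\<in>{..<v}. C_rel v `` {\<tau> i}) =
         (\<lambda>i\<in>{..<v}. C_rel v `` {subst \<tau> (\<sigma> i)})"
  by (intro subst_mult subst_monoidI) (use assms C_cls_self in simp_all)

lemma subst_monoid_one: "\<one>\<^bsub>subst_monoid v\<^esub> = (\<lambda>i\<in>{..<v}. C_rel v `` {Var i})"
  by (simp add: subst_monoid_def)

lemma subst_monoid_monoid: "monoid (subst_monoid v)"
proof
  fix x y assume x: "x \<in> carrier (subst_monoid v)" and y: "y \<in> carrier (subst_monoid v)"
  obtain \<sigma> where
    \<sigma>: "\<And>i. i < v \<Longrightarrow> \<sigma> i \<in> forms v 0" "x = (\<lambda>i\<in>{..<v}. C_rel v `` {\<sigma> i})"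
    using x by (rule subst_monoidE) blast
  obtain \<tau> where
    \<tau>: "\<And>i. i < v \<Longrightarrow> \<tau> i \<in> forms v 0" "y = (\<lambda>i\<in>{..<v}. C_rel v `` {\<tau> i})"
    using y by (rule subst_monoidE) blast
  show "x \<otimes>\<^bsub>subst_monoid v\<^esub> y \<in> carrier (subst_monoid v)"
    unfolding \<sigma>(2) \<tau>(2)
    by (subst subst_mult_cls) (auto simp: \<sigma>(1) \<tau>(1) intro!: subst_monoidI subst_forms)
next
  show "\<one>\<^bsub>subst_monoid v\<^esub> \<in> carrier (subst_monoid v)"
    unfolding subst_monoid_one by (rule subst_monoidI) simp
next
  fix x assume x: "x \<in> carrier (subst_monoid v)"
  obtain \<sigma> where
    \<sigma>: "\<And>i. i < v \<Longrightarrow> \<sigma> i \<in> forms v 0" "x = (\<lambda>i\<in>{..<v}. C_rel v `` {\<sigma> i})"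
    using x by (rule subst_monoidE) blast
  show "\<one>\<^bsub>subst_monoid v\<^esub> \<otimes>\<^bsub>subst_monoid v\<^esub> x = x"
    unfolding \<sigma>(2) subst_monoid_one by (subst subst_mult_cls) (simp_all add: \<sigma>(1))
  show "x \<otimes>\<^bsub>subst_monoid v\<^esub> \<one>\<^bsub>subst_monoid v\<^esub> = x"
    unfolding \<sigma>(2) subst_monoid_one by (subst subst_mult_cls) (simp_all add: \<sigma>(1) subst_Var)
next
  fix x y z
  assume x: "x \<in> carrier (subst_monoid v)" and y: "y \<in> carrier (subst_monoid v)"
    and z: "z \<in> carrier (subst_monoid v)"
  obtain \<sigma> where
    \<sigma>: "\<And>i. i < v \<Longrightarrow> \<sigma> i \<in> forms v 0" "x = (\<lambda>i\<in>{..<v}. C_rel v `` {\<sigma> i})"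
    using x by (rule subst_monoidE) blast
  obtain \<tau> where
    \<tau>: "\<And>i. i < v \<Longrightarrow> \<tau> i \<in> forms v 0" "y = (\<lambda>i\<in>{..<v}. C_rel v `` {\<tau> i})"
    using y by (rule subst_monoidE) blast
  obtain \<rho> where
    \<rho>: "\<And>i. i < v \<Longrightarrow> \<rho> i \<in> forms v 0" "z = (\<lambda>i\<in>{..<v}. C_rel v `` {\<rho> i})"
    using z by (rule subst_monoidE) blast
  have \<sigma>\<tau>: "subst \<tau> (\<sigma> i) \<in> forms v 0" and \<tau>\<rho>: "subst \<rho> (\<tau> i) \<in> forms v 0" if "i < v" for i
    using that by (auto simp: \<sigma>(1) \<tau>(1) \<rho>(1) intro!: subst_forms)
  show "x \<otimes>\<^bsub>subst_monoid v\<^esub> y \<otimes>\<^bsub>subst_monoid v\<^esub> z =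
        x \<otimes>\<^bsub>subst_monoid v\<^esub> (y \<otimes>\<^bsub>subst_monoid v\<^esub> z)"
    unfolding \<sigma>(2) \<tau>(2) \<rho>(2)
    by (simp add: subst_mult_cls \<sigma>(1) \<tau>(1) \<rho>(1) \<sigma>\<tau> \<tau>\<rho> subst_subst)
qed

lemma prime_substs_group: "group (prime_substs v)"
  unfolding prime_substs_def by (rule monoid.units_group[OF subst_monoid_monoid])

lemma Conj_forms: "Conj \<phi>s \<in> forms v d \<longleftrightarrow> set \<phi>s \<subseteq> forms v d"
  by (induction \<phi>s) (auto simp: Conj_def)

lemma set_signed_conjs:
  "set (signed_conjs \<phi>s) = {Conj (map2 lit bs \<phi>s) | bs. length bs = length \<phi>s}"
  by (auto simp: signed_conjs_def set_n_lists)

lemma signed_conjs_forms: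
  assumes "set \<phi>s \<subseteq> forms v d" "c \<in> set (signed_conjs \<phi>s)"
  shows "c \<in> forms v d"
  using assms by (fastforce simp: set_signed_conjs Conj_forms lit_def dest!: set_zip_rightD)

lemma minterm_list_forms: "set (minterm_list v d) \<subseteq> forms v d"
proof (induction d)
  case 0
  have "set (map Var [0..<v]) \<subseteq> forms v 0" by auto
  from signed_conjs_forms[OF this] show ?case by auto
next
  case (Suc d)
  have "set (map Var [0..<v]) \<subseteq> forms v (Suc d)"
    "set (map Dia (minterm_list v d)) \<subseteq> forms v (Suc d)"
    using Suc by auto
  from this[THEN signed_conjs_forms] show ?case by auto
qed

end

theory Submission
  imports Defs
begin

text \<open>
  Composition of substitutions acts on the algebra from the right and respects joins and meets, so
  an invertible substitution acts by a lattice automorphism. Every automorphism permutes the atoms,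
  and the minterms are exactly the atoms. Indeed some minterm is true under each valuation; a
  minterm decides every formula of its level, because \<open>Box \<phi>\<close> follows once \<open>Dia \<nu>\<close> is denied for
  all \<open>\<nu>\<close> of the level below that refute \<open>\<phi>\<close>; and a minterm is consistent, since it holds at the
  root of a finite tree whose subtrees realise precisely the \<open>\<nu>\<close> with \<open>Dia \<nu>\<close> asserted.
\<close>

section \<open>Automorphisms permute atoms\<close>

text \<open>Phrased without \<open>\<bottom>\<close>, which is an arbitrary element when \<open>L\<close> has no least one.\<close>

definition atoms :: "('a, 'b) gorder_scheme \<Rightarrow> 'a set" where
  "atoms L = {a \<in> carrier L. \<not> least L a (carrier L) \<and>
     (\<forall>x\<in>carrier L. x \<sqsubseteq>\<^bsub>L\<^esub> a \<longrightarrow> x = a \<or> least L x (carrier L))}"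

lemma order_emb_bij_image_atoms:
  assumes emb: "order_emb L M f" and bij: "bij_betw f (carrier L) (carrier M)"
  shows "f ` atoms L = atoms M"
proof -
  have image_carrier: "f ` carrier L = carrier M"
    using bij by (rule bij_betw_imp_surj_on)
  have le_iff: "f x \<sqsubseteq>\<^bsub>M\<^esub> f y \<longleftrightarrow> x \<sqsubseteq>\<^bsub>L\<^esub> y" and eq_iff: "f x = f y \<longleftrightarrow> x = y"
    if "x \<in> carrier L" "y \<in> carrier L" for x y
    using that emb bij by (auto simp: order_emb_def bij_betw_def inj_on_eq_iff)
  have least_iff: "least M (f x) (f ` carrier L) \<longleftrightarrow> least L x (carrier L)"
    if "x \<in> carrier L" for x
    using that by (auto simp: least_def le_iff simp flip: image_carrier)
  have "f x \<in> atoms M \<longleftrightarrow> x \<in> atoms L" if "x \<in> carrier L" for x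
    using that by (auto simp: atoms_def le_iff eq_iff least_iff simp flip: image_carrier)
  moreover have "atoms L \<subseteq> carrier L" "atoms M \<subseteq> f ` carrier L"
    by (auto simp: atoms_def image_carrier)
  ultimately show ?thesis
    by blast
qed

lemma join_pres_inj_order_emb:
  assumes f: "f \<in> carrier L \<rightarrow> carrier M" and join: "join_pres L M f"
    and inj: "inj_on f (carrier L)"
  shows "order_emb L M f"
proof -
  interpret L: lattice L
    using join by (simp add: join_pres_def)
  interpret M: lattice M
    using join by (simp add: join_pres_def)
  have "f x \<sqsubseteq>\<^bsub>M\<^esub> f y \<longleftrightarrow> x \<sqsubseteq>\<^bsub>L\<^esub> y" if x: "x \<in> carrier L" and y: "y \<in> carrier L" for x y
  proof -
    have "f x \<sqsubseteq>\<^bsub>M\<^esub> f y \<longleftrightarrow> f x \<squnion>\<^bsub>M\<^esub> f y = f y"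
      using f x y by (intro M.le_iff_meet) auto
    also have "\<dots> \<longleftrightarrow> f (x \<squnion>\<^bsub>L\<^esub> y) = f y"
      using join x y by (simp add: join_pres_def)
    also have "\<dots> \<longleftrightarrow> x \<sqsubseteq>\<^bsub>L\<^esub> y"
      using inj x y by (simp add: inj_on_eq_iff L.le_iff_meet)
    finally show ?thesis .
  qed
  then show ?thesis
    using join_pres_isotone[OF f join] by (simp add: order_emb_def isotone_def)
qed

lemma lattice_automorphism_bij_betw_atoms:
  assumes "lattice_automorphism L f"
  shows "bij_betw f (atoms L) (atoms L)"
proof -
  have bij: "bij_betw f (carrier L) (carrier L)" and join: "join_pres L L f"
    using assms by (simp_all add: lattice_automorphism_def)
  then have "order_emb L L f"
    by (intro join_pres_inj_order_emb) (auto simp: bij_betw_def)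
  then have "f ` atoms L = atoms L"
    using bij by (rule order_emb_bij_image_atoms)
  then show ?thesis
    by (rule bij_betw_subset[OF bij, rotated]) (auto simp: atoms_def)
qed


section \<open>Invertible substitutions act by automorphisms\<close>

lemma K_act_subst:
  assumes "\<And>i. i < v \<Longrightarrow> \<sigma> i \<in> forms v 0" "\<phi> \<in> forms v d"
  shows "K_act v d (\<lambda>i\<in>{..<v}. C_rel v `` {\<sigma> i}) (K_cls v d \<phi>) = K_cls v d (subst \<sigma> \<phi>)"
  using assms by (intro K_act_cls subst_monoidI) (simp_all add: C_cls_self del: Image_singleton_iff)

lemma K_act_closed:
  assumes "S \<in> carrier (subst_monoid v)" "X \<in> carrier (K_alg v d)"
  shows "K_act v d S X \<in> carrier (K_alg v d)"
  using assms
  by (auto elim!: subst_monoidE K_alg_carrierE simp: K_act_subst intro!: K_cls_carrier subst_forms)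

lemma K_act_one:
  assumes "X \<in> carrier (K_alg v d)"
  shows "K_act v d \<one>\<^bsub>subst_monoid v\<^esub> X = X"
  using assms by (auto elim!: K_alg_carrierE simp: subst_monoid_one K_act_subst subst_Var)

lemma K_act_mult:
  assumes S: "S \<in> carrier (subst_monoid v)" and T: "T \<in> carrier (subst_monoid v)"
    and X: "X \<in> carrier (K_alg v d)"
  shows "K_act v d (S \<otimes>\<^bsub>subst_monoid v\<^esub> T) X = K_act v d T (K_act v d S X)"
proof -
  obtain \<sigma> where \<sigma>: "\<And>i. i < v \<Longrightarrow> \<sigma> i \<in> forms v 0"
    and S_eq: "S = (\<lambda>i\<in>{..<v}. C_rel v `` {\<sigma> i})"
    using S by (rule subst_monoidE) blast
  obtain \<tau> where \<tau>: "\<And>i. i < v \<Longrightarrow> \<tau> i \<in> forms v 0"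
    and T_eq: "T = (\<lambda>i\<in>{..<v}. C_rel v `` {\<tau> i})"
    using T by (rule subst_monoidE) blast
  obtain \<phi> where \<phi>: "\<phi> \<in> forms v d" and X_eq: "X = K_cls v d \<phi>"
    using X by (rule K_alg_carrierE)
  show ?thesis
    unfolding S_eq T_eq X_eq
    by (simp add: subst_mult_cls K_act_subst subst_forms subst_subst \<sigma> \<tau> \<phi>)
qed

lemma K_act_join_pres:
  assumes "S \<in> carrier (subst_monoid v)"
  shows "join_pres (K_alg v d) (K_alg v d) (K_act v d S)"
  using assms K_alg_lattice
  by (auto elim!: subst_monoidE K_alg_carrierE
      simp: join_pres_def K_alg_join K_act_subst subst_forms)

lemma K_act_meet_pres:
  assumes "S \<in> carrier (subst_monoid v)"
  shows "meet_pres (K_alg v d) (K_alg v d) (K_act v d S)"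
  using assms K_alg_lattice
  by (auto elim!: subst_monoidE K_alg_carrierE
      simp: meet_pres_def K_alg_meet K_act_subst subst_forms)

lemma K_act_lattice_automorphism:
  assumes "S \<in> carrier (prime_substs v)"
  shows "lattice_automorphism (K_alg v d) (K_act v d S)"
proof -
  interpret monoid "subst_monoid v"
    by (rule subst_monoid_monoid)
  have unit: "S \<in> Units (subst_monoid v)"
    using assms by (simp add: prime_substs_def units_of_def)
  define T where "T = inv\<^bsub>subst_monoid v\<^esub> S"
  have S: "S \<in> carrier (subst_monoid v)" and T: "T \<in> carrier (subst_monoid v)"
    using unit by (simp_all add: T_def Units_closed)
  have "bij_betw (K_act v d S) (carrier (K_alg v d)) (carrier (K_alg v d))"
  proof (rule bij_betw_byWitness[where f' = "K_act v d T"])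
    show "\<forall>X\<in>carrier (K_alg v d). K_act v d T (K_act v d S X) = X"
      using unit S T by (simp add: T_def K_act_one flip: K_act_mult)
    show "\<forall>X\<in>carrier (K_alg v d). K_act v d S (K_act v d T X) = X"
      using unit S T by (simp add: T_def K_act_one flip: K_act_mult)
  qed (use S T K_act_closed in auto)
  then show ?thesis
    using S by (simp add: lattice_automorphism_def K_act_join_pres K_act_meet_pres)
qed


section \<open>Soundness for finite trees\<close>

datatype ktree = KNode (label: "nat set") (children: "ktree list")

primrec sat :: "ktree \<Rightarrow> fm \<Rightarrow> bool" where
  "sat t Bot \<longleftrightarrow> False"
| "sat t (Var i) \<longleftrightarrow> i \<in> label t"
| "sat t (Imp \<phi> \<psi>) \<longleftrightarrow> (sat t \<phi> \<longrightarrow> sat t \<psi>)"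
| "sat t (Box \<phi>) \<longleftrightarrow> (\<forall>u\<in>set (children t). sat u \<phi>)"

primrec relabel :: "(nat \<Rightarrow> fm) \<Rightarrow> ktree \<Rightarrow> ktree" where
  "relabel \<sigma> (KNode A ts) = KNode {i. sat (KNode A ts) (\<sigma> i)} (map (relabel \<sigma>) ts)"

lemma sat_subst: "sat t (subst \<sigma> \<phi>) = sat (relabel \<sigma> t) \<phi>"
proof (induction \<phi> arbitrary: t)
  case (Var i)
  show ?case by (cases t) simp
next
  case (Box \<phi>)
  then show ?case by (cases t) simp
qed simp_all

lemma tval_sat: "tval (sat t) = sat t"
proof
  show "tval (sat t) \<phi> = sat t \<phi>" for \<phi>
    by (induction \<phi>) auto
qed

lemma logicK_sat:
  assumes "\<phi> \<in> logicK"
  shows "sat t \<phi>"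
proof -
  have "sat t \<phi>" if "taut \<phi>" for t \<phi>
    using that unfolding taut_def by (metis tval_sat)
  then have "normal_logic {\<phi>. \<forall>t. sat t \<phi>}"
    by (auto simp: normal_logic_def sat_subst)
  then show ?thesis
    using assms unfolding logicK_def by blast
qed


section \<open>Derivations in K\<close>

lemma K_taut_list:
  assumes "set \<Gamma> \<subseteq> logicK" "\<And>V. \<forall>\<gamma>\<in>set \<Gamma>. tval V \<gamma> \<Longrightarrow> tval V \<chi>"
  shows "\<chi> \<in> logicK"
  using assms
proof (induction \<Gamma> arbitrary: \<chi>)
  case Nil
  then show ?case by (auto intro: K_taut simp: taut_def)
next
  case (Cons \<gamma> \<Gamma>)
  have "Imp \<gamma> \<chi> \<in> logicK"
    using Cons.prems by (intro Cons.IH) auto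
  then show ?case
    using Cons.prems(1) by (auto intro: K_mp[of \<gamma>])
qed

lemma K_Imp_Box_Conj:
  assumes "Imp (Conj \<Gamma>) \<phi> \<in> logicK" "\<And>\<gamma>. \<gamma> \<in> set \<Gamma> \<Longrightarrow> Imp \<mu> (Box \<gamma>) \<in> logicK"
  shows "Imp \<mu> (Box \<phi>) \<in> logicK"
  using assms
proof (induction \<Gamma> arbitrary: \<phi>)
  case Nil
  have "\<phi> \<in> logicK"
    using Nil.prems(1) by (rule K_taut1) (simp add: Conj_def taut_def)
  then show ?case
    by (rule K_taut1[OF K_nec]) (simp add: taut_def)
next
  case (Cons \<gamma> \<Gamma>)
  have "Imp (Conj \<Gamma>) (Imp \<gamma> \<phi>) \<in> logicK"
    using Cons.prems(1) by (rule K_taut1) (simp add: Conj_def taut_def)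
  then have "Imp \<mu> (Box (Imp \<gamma> \<phi>)) \<in> logicK"
    by (rule Cons.IH) (simp add: Cons.prems(2))
  then have "Imp \<mu> (Imp (Box \<gamma>) (Box \<phi>)) \<in> logicK"
    using K_dist by (rule K_Imp_trans)
  moreover have "Imp \<mu> (Box \<gamma>) \<in> logicK"
    using Cons.prems(2) by simp
  ultimately show ?case
    by (rule K_taut2) (simp add: taut_def)
qed

definition decides :: "fm \<Rightarrow> fm \<Rightarrow> bool" where
  "decides \<mu> \<phi> \<longleftrightarrow> Imp \<mu> \<phi> \<in> logicK \<or> Imp \<mu> (Neg \<phi>) \<in> logicK"

lemma decides_strengthen:
  assumes "decides \<nu> \<phi>" "Imp \<mu> \<nu> \<in> logicK"
  shows "decides \<mu> \<phi>"
  using assms K_Imp_trans unfolding decides_def by blast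

lemma decides_Bot: "decides \<mu> Bot"
proof -
  have "Imp \<mu> (Neg Bot) \<in> logicK"
    by (rule K_taut) (simp add: taut_def)
  then show ?thesis
    by (simp add: decides_def)
qed

lemma decides_Imp:
  assumes "decides \<mu> \<phi>" "decides \<mu> \<psi>"
  shows "decides \<mu> (Imp \<phi> \<psi>)"
proof -
  consider (refutes_antecedent) "Imp \<mu> (Neg \<phi>) \<in> logicK"
    | (proves_consequent) "Imp \<mu> \<psi> \<in> logicK"
    | (refutes_implication) "Imp \<mu> \<phi> \<in> logicK" "Imp \<mu> (Neg \<psi>) \<in> logicK"
    using assms unfolding decides_def by blast
  then show ?thesis
  proof cases
    case refutes_antecedent
    then have "Imp \<mu> (Imp \<phi> \<psi>) \<in> logicK"
      by (rule K_taut1) (simp add: taut_def)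
    then show ?thesis by (simp add: decides_def)
  next
    case proves_consequent
    then have "Imp \<mu> (Imp \<phi> \<psi>) \<in> logicK"
      by (rule K_taut1) (simp add: taut_def)
    then show ?thesis by (simp add: decides_def)
  next
    case refutes_implication
    then have "Imp \<mu> (Neg (Imp \<phi> \<psi>)) \<in> logicK"
      by (rule K_taut2) (simp add: taut_def)
    then show ?thesis by (simp add: decides_def)
  qed
qed


section \<open>Signed conjunctions\<close>

lemma tval_Conj: "tval V (Conj \<phi>s) \<longleftrightarrow> (\<forall>\<phi>\<in>set \<phi>s. tval V \<phi>)"
  by (induction \<phi>s) (auto simp: Conj_def)

lemma tval_Conj_lits:
  assumes "length bs = length \<phi>s"
  shows "tval V (Conj (map2 lit bs \<phi>s)) \<longleftrightarrow> map (tval V) \<phi>s = bs"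
  using assms by (induction bs \<phi>s rule: list_induct2) (auto simp: Conj_def lit_def)

lemma ex1_signed_conj: "\<exists>!c. c \<in> set (signed_conjs \<phi>s) \<and> tval V c"
proof
  show "Conj (map2 lit (map (tval V) \<phi>s) \<phi>s) \<in> set (signed_conjs \<phi>s) \<and>
      tval V (Conj (map2 lit (map (tval V) \<phi>s) \<phi>s))"
    by (auto simp: set_signed_conjs tval_Conj_lits)
  show "c = Conj (map2 lit (map (tval V) \<phi>s) \<phi>s)"
    if "c \<in> set (signed_conjs \<phi>s) \<and> tval V c" for c
    using that by (auto simp: set_signed_conjs tval_Conj_lits)
qed

lemma signed_conj_decides:
  assumes "c \<in> set (signed_conjs \<phi>s)" "\<phi> \<in> set \<phi>s"
  shows "decides c \<phi>"
proof -
  obtain bs where length: "length bs = length \<phi>s" and c_eq: "c = Conj (map2 lit bs \<phi>s)"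
    using assms(1) by (auto simp: set_signed_conjs)
  obtain i where "i < length \<phi>s" "\<phi> = \<phi>s ! i"
    using assms(2) by (auto simp: in_set_conv_nth)
  then have "tval V \<phi> \<longleftrightarrow> bs ! i" if "tval V c" for V
    using that length by (auto simp: c_eq tval_Conj_lits)
  then have "taut (Imp c \<phi>) \<or> taut (Imp c (Neg \<phi>))"
    by (auto simp: taut_def)
  then show ?thesis
    using K_taut by (auto simp: decides_def)
qed

lemma lit_inject: "lit b \<phi> = lit c \<phi> \<longleftrightarrow> b = c"
proof -
  have "\<phi> \<noteq> Neg \<phi>"
    by (induction \<phi>) auto
  then show ?thesis
    by (auto simp: lit_def dest: sym)
qed

lemma inj_on_Conj_lits: "inj_on (\<lambda>bs. Conj (map2 lit bs \<phi>s)) {bs. length bs = length \<phi>s}"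
proof (rule inj_onI)
  fix bs cs :: "bool list"
  assume "bs \<in> {bs. length bs = length \<phi>s}" "cs \<in> {bs. length bs = length \<phi>s}"
    and "Conj (map2 lit bs \<phi>s) = Conj (map2 lit cs \<phi>s)"
  then have "length bs = length cs" "length cs = length \<phi>s"
    "Conj (map2 lit bs \<phi>s) = Conj (map2 lit cs \<phi>s)"
    by simp_all
  then show "bs = cs"
    by (induction bs cs \<phi>s rule: list_induct3) (simp_all add: Conj_def lit_inject)
qed

lemma distinct_signed_conjs: "distinct (signed_conjs \<phi>s)"
  by (auto simp: signed_conjs_def distinct_map distinct_n_lists set_n_lists
      intro: inj_on_subset[OF inj_on_Conj_lits])


section \<open>Minterms decide all formulas of their level\<close>

lemma ex1_minterm: "\<exists>!\<mu>. \<mu> \<in> set (minterm_list v d) \<and> tval V \<mu>"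
proof (cases d)
  case 0
  then show ?thesis by (simp add: ex1_signed_conj)
next
  case (Suc e)
  obtain m c where "m \<in> set (signed_conjs (map Var [0..<v]))" "tval V m"
    "c \<in> set (signed_conjs (map Dia (minterm_list v e)))" "tval V c"
    using ex1_signed_conj by metis
  then show ?thesis
    using ex1_signed_conj[of "map Var [0..<v]" V]
      ex1_signed_conj[of "map Dia (minterm_list v e)" V]
    unfolding Suc by (intro ex1I[of _ "And m c"]) auto
qed

lemma K_minterm_cases:
  assumes "\<And>\<mu>. \<mu> \<in> set (minterm_list v d) \<Longrightarrow> Imp \<mu> \<chi> \<in> logicK"
  shows "\<chi> \<in> logicK"
proof (rule K_taut_list)
  show "set (map (\<lambda>\<mu>. Imp \<mu> \<chi>) (minterm_list v d)) \<subseteq> logicK"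
    using assms by auto
  show "tval V \<chi>" if "\<forall>\<gamma>\<in>set (map (\<lambda>\<mu>. Imp \<mu> \<chi>) (minterm_list v d)). tval V \<gamma>" for V
    using that ex1_minterm[of v d V] by auto
qed

lemma minterm_decides_Var:
  assumes "\<mu> \<in> set (minterm_list v d)" "i < v"
  shows "decides \<mu> (Var i)"
proof -
  have "\<exists>m\<in>set (signed_conjs (map Var [0..<v])). taut (Imp \<mu> m)"
    using assms(1) by (cases d) (force simp: taut_def)+
  then obtain m where "m \<in> set (signed_conjs (map Var [0..<v]))" "Imp \<mu> m \<in> logicK"
    using K_taut by blast
  then show ?thesis
    using assms(2) by (intro decides_strengthen[OF signed_conj_decides]) auto
qed

lemma minterm_decides_Dia:
  assumes "\<mu> \<in> set (minterm_list v (Suc d))" "\<nu> \<in> set (minterm_list v d)"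
  shows "decides \<mu> (Dia \<nu>)"
proof -
  obtain m c where c: "c \<in> set (signed_conjs (map Dia (minterm_list v d)))" and \<mu>_eq: "\<mu> = And m c"
    using assms(1) by auto
  have "Imp \<mu> c \<in> logicK"
    by (rule K_taut) (simp add: \<mu>_eq taut_def)
  then show ?thesis
    using c assms(2) by (intro decides_strengthen[OF signed_conj_decides]) auto
qed

definition refuting_minterms :: "nat \<Rightarrow> nat \<Rightarrow> fm \<Rightarrow> fm list" where
  "refuting_minterms v d \<phi> = filter (\<lambda>\<nu>. Imp \<nu> (Neg \<phi>) \<in> logicK) (minterm_list v d)"

lemma K_Imp_Conj_Neg_refuting_minterms:
  assumes "\<And>\<nu>. \<nu> \<in> set (minterm_list v d) \<Longrightarrow> decides \<nu> \<phi>"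
  shows "Imp (Conj (map Neg (refuting_minterms v d \<phi>))) \<phi> \<in> logicK"
proof (rule K_minterm_cases)
  fix \<nu> assume \<nu>: "\<nu> \<in> set (minterm_list v d)"
  show "Imp \<nu> (Imp (Conj (map Neg (refuting_minterms v d \<phi>))) \<phi>) \<in> logicK"
  proof (cases "\<nu> \<in> set (refuting_minterms v d \<phi>)")
    case True
    then show ?thesis
      by (intro K_taut) (auto simp: taut_def tval_Conj)
  next
    case False
    then have "Imp \<nu> \<phi> \<in> logicK"
      using \<nu> assms by (auto simp: refuting_minterms_def decides_def)
    then show ?thesis
      by (rule K_taut1) (simp add: taut_def)
  qed
qed

lemma minterm_decides_Box:
  assumes \<mu>: "\<mu> \<in> set (minterm_list v (Suc d))"
    and decides_\<phi>: "\<And>\<nu>. \<nu> \<in> set (minterm_list v d) \<Longrightarrow> decides \<nu> \<phi>"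
  shows "decides \<mu> (Box \<phi>)"
proof (cases "\<exists>\<nu>\<in>set (refuting_minterms v d \<phi>). Imp \<mu> (Dia \<nu>) \<in> logicK")
  case True
  then obtain \<nu> where "Imp \<nu> (Neg \<phi>) \<in> logicK" and Dia: "Imp \<mu> (Dia \<nu>) \<in> logicK"
    by (auto simp: refuting_minterms_def)
  then have "Imp \<phi> (Neg \<nu>) \<in> logicK"
    by (auto elim: K_taut1 simp: taut_def)
  then have "Imp (Box \<phi>) (Box (Neg \<nu>)) \<in> logicK"
    by (rule K_Box_mono)
  with Dia have "Imp \<mu> (Neg (Box \<phi>)) \<in> logicK"
    by (rule K_taut2) (auto simp: taut_def)
  then show ?thesis
    by (simp add: decides_def)
next
  case False
  have Box_Neg: "Imp \<mu> (Box (Neg \<nu>)) \<in> logicK" if "\<nu> \<in> set (refuting_minterms v d \<phi>)" for \<nu>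
  proof -
    have "Imp \<mu> (Neg (Dia \<nu>)) \<in> logicK"
      using that False minterm_decides_Dia[OF \<mu>, of \<nu>]
      by (auto simp: refuting_minterms_def decides_def)
    then show ?thesis
      by (rule K_taut1) (simp add: taut_def)
  qed
  have "Imp \<mu> (Box \<phi>) \<in> logicK"
    using K_Imp_Conj_Neg_refuting_minterms[OF decides_\<phi>]
    by (rule K_Imp_Box_Conj) (auto intro: Box_Neg)
  then show ?thesis
    by (simp add: decides_def)
qed

lemma minterm_decides:
  assumes "\<mu> \<in> set (minterm_list v d)" "\<phi> \<in> forms v d"
  shows "decides \<mu> \<phi>"
  using assms
proof (induction \<phi> arbitrary: d \<mu>)
  case Bot
  show ?case by (rule decides_Bot)
next
  case (Var i)
  then show ?case by (simp add: minterm_decides_Var)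
next
  case (Imp \<phi> \<psi>)
  then show ?case by (simp add: decides_Imp)
next
  case (Box \<phi>)
  then obtain e where "d = Suc e" "\<phi> \<in> forms v e"
    by (cases d) (auto simp: forms_def)
  with Box show ?case
    by (blast intro: minterm_decides_Box)
qed


section \<open>Minterms are consistent\<close>

lemma distinct_minterm_list: "distinct (minterm_list v d)"
proof (cases d)
  case 0
  then show ?thesis by (simp add: distinct_signed_conjs)
next
  case (Suc e)
  have "minterm_list v d = map (\<lambda>(m, c). And m c)
      (List.product (signed_conjs (map Var [0..<v])) (signed_conjs (map Dia (minterm_list v e))))"
    by (simp add: Suc product_concat_map map_concat comp_def)
  then show ?thesis
    by (auto simp: distinct_map distinct_product distinct_signed_conjs inj_on_def)
qed

lemma ex_set_map_mem_eq:
  assumes "length bs = length xs" "distinct xs"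
  shows "\<exists>A. map (\<lambda>x. x \<in> A) xs = bs"
proof
  show "map (\<lambda>x. x \<in> {x. (x, True) \<in> set (zip xs bs)}) xs = bs"
    using assms by (auto simp: in_set_zip nth_eq_iff_index_eq intro!: nth_equalityI)
qed

lemmas sat_Conj_lits = tval_Conj_lits[of _ _ "sat t" for t, unfolded tval_sat]

lemma sat_signed_conj_Var:
  assumes "m \<in> set (signed_conjs (map Var [0..<v]))"
  obtains A where "\<And>ts. sat (KNode A ts) m"
proof -
  obtain bs where length: "length bs = v" and m_eq: "m = Conj (map2 lit bs (map Var [0..<v]))"
    using assms by (auto simp: set_signed_conjs)
  obtain A where "map (\<lambda>i. i \<in> A) [0..<v] = bs"
    using ex_set_map_mem_eq[of bs "[0..<v]"] length by auto
  then have "sat (KNode A ts) m" for ts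
    using length by (simp add: m_eq sat_Conj_lits comp_def)
  then show thesis
    by (rule that)
qed

lemma sat_signed_conj_Dia:
  assumes distinct: "distinct \<phi>s" and c: "c \<in> set (signed_conjs (map Dia \<phi>s))"
    and tree: "\<And>\<phi> \<psi>. \<phi> \<in> set \<phi>s \<Longrightarrow> \<psi> \<in> set \<phi>s \<Longrightarrow> sat (tree \<phi>) \<psi> \<longleftrightarrow> \<psi> = \<phi>"
  obtains ts where "\<And>A. sat (KNode A ts) c"
proof -
  obtain bs where length: "length bs = length \<phi>s" and c_eq: "c = Conj (map2 lit bs (map Dia \<phi>s))"
    using c by (auto simp: set_signed_conjs)
  obtain B where bs_eq: "map (\<lambda>\<phi>. \<phi> \<in> B) \<phi>s = bs"
    using ex_set_map_mem_eq[OF length distinct] by blast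
  define ts where "ts = map tree (filter (\<lambda>\<phi>. \<phi> \<in> B) \<phi>s)"
  have "sat (KNode A ts) (Dia \<phi>) \<longleftrightarrow> \<phi> \<in> B" if "\<phi> \<in> set \<phi>s" for A \<phi>
    using that tree by (auto simp: ts_def)
  then have "sat (KNode A ts) c" for A
    by (simp add: c_eq sat_Conj_lits flip: bs_eq)
  then show thesis
    by (rule that)
qed

lemma minterm_satisfiable:
  assumes "\<mu> \<in> set (minterm_list v d)"
  shows "\<exists>t. sat t \<mu>"
  using assms
proof (induction d arbitrary: \<mu>)
  case 0
  then show ?case by (auto elim: sat_signed_conj_Var)
next
  case (Suc d)
  obtain m c where m: "m \<in> set (signed_conjs (map Var [0..<v]))"
    and c: "c \<in> set (signed_conjs (map Dia (minterm_list v d)))" and \<mu>_eq: "\<mu> = And m c"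
    using Suc.prems by auto
  obtain tree where "\<And>\<nu>. \<nu> \<in> set (minterm_list v d) \<Longrightarrow> sat (tree \<nu>) \<nu>"
    using Suc.IH by metis
  then have "sat (tree \<nu>) \<nu>' \<longleftrightarrow> \<nu>' = \<nu>"
    if "\<nu> \<in> set (minterm_list v d)" "\<nu>' \<in> set (minterm_list v d)" for \<nu> \<nu>'
    using that ex1_minterm[of v d "sat (tree \<nu>)"] unfolding tval_sat by blast
  then obtain ts where "\<And>A. sat (KNode A ts) c"
    using sat_signed_conj_Dia[OF distinct_minterm_list c] by blast
  moreover obtain A where "\<And>ts. sat (KNode A ts) m"
    using m by (rule sat_signed_conj_Var) blast
  ultimately show ?case
    by (auto simp: \<mu>_eq)
qed

lemma minterm_consistent:
  assumes "\<mu> \<in> set (minterm_list v d)"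
  shows "Neg \<mu> \<notin> logicK"
  using minterm_satisfiable[OF assms] logicK_sat[of "Neg \<mu>"] by auto


section \<open>Minterms are the atoms\<close>

lemma K_cls_eq_iff:
  assumes "\<phi> \<in> forms v d" "\<psi> \<in> forms v d"
  shows "K_cls v d \<phi> = K_cls v d \<psi> \<longleftrightarrow> Iff \<phi> \<psi> \<in> logicK"
  using assms eq_equiv_class_iff[OF K_rel_equiv, of \<phi> v d \<psi>] by (simp add: K_cls_def K_rel_def)

lemma least_K_cls_iff:
  assumes "\<phi> \<in> forms v d"
  shows "least (K_alg v d) (K_cls v d \<phi>) (carrier (K_alg v d)) \<longleftrightarrow> Neg \<phi> \<in> logicK"
proof
  assume "least (K_alg v d) (K_cls v d \<phi>) (carrier (K_alg v d))"
  then have "K_cls v d \<phi> \<sqsubseteq>\<^bsub>K_alg v d\<^esub> K_cls v d Bot"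
    by (intro least_le) (auto intro: K_cls_carrier)
  then show "Neg \<phi> \<in> logicK"
    using assms by (simp add: K_alg_le)
next
  assume "Neg \<phi> \<in> logicK"
  then have "Imp \<phi> \<psi> \<in> logicK" for \<psi>
    by (rule K_taut1) (simp add: taut_def)
  then show "least (K_alg v d) (K_cls v d \<phi>) (carrier (K_alg v d))"
    using assms by (auto simp: least_def K_alg_le intro: K_cls_carrier elim!: K_alg_carrierE)
qed

lemma K_cls_mem_atoms_iff:
  assumes "\<phi> \<in> forms v d"
  shows "K_cls v d \<phi> \<in> atoms (K_alg v d) \<longleftrightarrow> Neg \<phi> \<notin> logicK \<and>
    (\<forall>\<psi>\<in>forms v d. Imp \<psi> \<phi> \<in> logicK \<longrightarrow> Imp \<phi> \<psi> \<in> logicK \<or> Neg \<psi> \<in> logicK)"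
proof -
  have "(\<forall>X\<in>carrier (K_alg v d). P X) \<longleftrightarrow> (\<forall>\<psi>\<in>forms v d. P (K_cls v d \<psi>))" for P
    by (auto elim: K_alg_carrierE intro: K_cls_carrier)
  then show ?thesis
    using assms
    by (simp add: atoms_def K_cls_carrier K_alg_le K_cls_eq_iff least_K_cls_iff K_Iff)
qed

lemma minterms_subset_atoms: "minterms v d \<subseteq> atoms (K_alg v d)"
proof
  fix X assume "X \<in> minterms v d"
  then obtain \<mu> where \<mu>: "\<mu> \<in> set (minterm_list v d)" and X_eq: "X = K_cls v d \<mu>"
    by (auto simp: minterms_def)
  have "Imp \<mu> \<phi> \<in> logicK \<or> Neg \<phi> \<in> logicK" if "\<phi> \<in> forms v d" "Imp \<phi> \<mu> \<in> logicK" for \<phi>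
  proof -
    have "Neg \<phi> \<in> logicK" if "Imp \<mu> (Neg \<phi>) \<in> logicK"
      using \<open>Imp \<phi> \<mu> \<in> logicK\<close> that by (rule K_taut2) (auto simp: taut_def)
    then show ?thesis
      using minterm_decides[OF \<mu> that(1)] by (auto simp: decides_def)
  qed
  moreover have "\<mu> \<in> forms v d"
    using \<mu> minterm_list_forms by blast
  ultimately show "X \<in> atoms (K_alg v d)"
    using minterm_consistent[OF \<mu>] by (simp add: X_eq K_cls_mem_atoms_iff)
qed

lemma atoms_subset_minterms: "atoms (K_alg v d) \<subseteq> minterms v d"
proof
  fix X assume atom: "X \<in> atoms (K_alg v d)"
  then obtain \<phi> where \<phi>: "\<phi> \<in> forms v d" and X_eq: "X = K_cls v d \<phi>"
    by (auto simp: atoms_def elim: K_alg_carrierE)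
  have "Neg \<phi> \<notin> logicK"
    using atom \<phi> by (simp add: X_eq K_cls_mem_atoms_iff)
  then obtain \<mu> where \<mu>: "\<mu> \<in> set (minterm_list v d)" and "Imp \<mu> (Neg \<phi>) \<notin> logicK"
    using K_minterm_cases by blast
  then have below: "Imp \<mu> \<phi> \<in> logicK"
    using \<phi> minterm_decides by (auto simp: decides_def)
  have \<mu>_forms: "\<mu> \<in> forms v d"
    using \<mu> minterm_list_forms by blast
  then have "Imp \<phi> \<mu> \<in> logicK"
    using atom \<phi> below minterm_consistent[OF \<mu>] by (auto simp: X_eq K_cls_mem_atoms_iff)
  then have "X = K_cls v d \<mu>"
    using \<phi> \<mu>_forms below by (simp add: X_eq K_cls_eq_iff K_Iff)
  then show "X \<in> minterms v d"
    using \<mu> by (simp add: minterms_def)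
qed

theorem minterms_eq_atoms: "minterms v d = atoms (K_alg v d)"
  using minterms_subset_atoms atoms_subset_minterms by (rule subset_antisym)

theorem theorem4:
  fixes v d :: nat and \<sigma> :: "nat \<Rightarrow> fm set"
  assumes "\<sigma> \<in> carrier (prime_substs v)"
  shows "bij_betw (K_act v d \<sigma>) (minterms v d) (minterms v d) \<and>
         lattice_automorphism (K_alg v d) (K_act v d \<sigma>)"
proof
  show automorphism: "lattice_automorphism (K_alg v d) (K_act v d \<sigma>)"
    using assms by (rule K_act_lattice_automorphism)
  show "bij_betw (K_act v d \<sigma>) (minterms v d) (minterms v d)"
    unfolding minterms_eq_atoms using automorphism by (rule lattice_automorphism_bij_betw_atoms)
qed

end
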